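(* Let $a,b\in\mathbb{C}\setminus\{-1,-2,-3,\ldots\}$. Then the following equalities hold: (i) $$\prod_{n\ge1}\left(\frac{(n+a)(2n+a+1)(2n+b)}{(2n+a)(n+b)(2n+b+1)}\right)^{(-1)^{t_n}}=\frac{b+1}{a+1};$$ (ii) $$\prod_{n\ge1}\left(\frac{(n+a)(2n+a+1)^2}{(2n+a)(2n+a+2)(n+a+1)}\right)^{(-1)^{t_n}}=\frac{a+2}{a+1};$$ (iii) $$\prod_{n\ge1}\left(\frac{(2n+2a)(2n+a+1)}{(2n+a)(2n+1)}\right)^{(-1)^{t_n}}=\frac{1}{a+1}.$$ Moreover, for every $a\in\mathbb{C}\setminus\left(\{0,-1,-2,-3,\ldots\}\cup\{-1/2,-3/2,-5/2,\ldots\}\right)$, (iv) $$\prod_{n\ge1}\left(\frac{(2n+a+1)(2n+2a-1)}{(2n+a)(2n+4a-2)}\right)^{(-1)^{t_n}}=\frac{2a}{a+1}.$$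
   Context: For an integer $n\ge 0$, $t_n\in\{0,1\}$ denotes the sum modulo $2$ of the binary digits of $n$ (the Thue-Morse sequence $0,1,1,0,1,0,0,1,\ldots$); equivalently $t_0=0$, $t_{2n}=t_n$, $t_{2n+1}=1-t_n$. Infinite products are limits of the partial products taken in increasing order of $n$. *)

theory Defs
  imports Complex_Main
begin

(* The digit of n at position k is n div 2 ^ k mod 2. It is 0 for k \<ge> n, because then
   n < 2 ^ k, so the sum below runs over all nonzero binary digits of n. *)
definition thue_morse :: "nat \<Rightarrow> nat" where
  "thue_morse n = (\<Sum>k<n. n div 2 ^ k mod 2) mod 2"

lemma binary_digit_sum_eq:
  assumes "n \<le> m"
  shows "(\<Sum>k<m. n div 2 ^ k mod 2) = (\<Sum>k<n. n div 2 ^ k mod (2::nat))"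
proof (rule sum.mono_neutral_right)
  show "\<forall>k\<in>{..<m} - {..<n}. n div 2 ^ k mod 2 = 0"
  proof
    fix k assume "k \<in> {..<m} - {..<n}"
    then have "n < 2 ^ k"
      using less_exp[of k] by (simp del: less_exp)
    then show "n div 2 ^ k mod 2 = 0" by simp
  qed
qed (use assms in auto)

lemma thue_morse_0: "thue_morse 0 = 0"
  by (simp add: thue_morse_def)

lemma thue_morse_step:
  assumes "r < 2"
  shows "thue_morse (2 * n + r) = (r + thue_morse n) mod 2"
proof -
  have "(\<Sum>k<2 * n + r. (2 * n + r) div 2 ^ k mod 2)
      = (\<Sum>k<Suc (2 * n + r). (2 * n + r) div 2 ^ k mod 2)"
    by (rule binary_digit_sum_eq[symmetric]) simp
  also have "\<dots> = (2 * n + r) mod 2 + (\<Sum>k<2 * n + r. (2 * n + r) div 2 ^ Suc k mod 2)"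
    by (subst sum.lessThan_Suc_shift) simp
  also have "(2 * n + r) mod 2 = r"
    using assms by simp
  also have "(\<Sum>k<2 * n + r. (2 * n + r) div 2 ^ Suc k mod 2)
      = (\<Sum>k<2 * n + r. n div 2 ^ k mod 2)"
    using assms by (simp add: div_mult2_eq)
  also have "\<dots> = (\<Sum>k<n. n div 2 ^ k mod 2)"
    by (rule binary_digit_sum_eq) simp
  finally show ?thesis
    by (simp add: thue_morse_def mod_add_right_eq)
qed

lemma thue_morse_double: "thue_morse (2 * n) = thue_morse n"
  using thue_morse_step[of 0 n] by (simp add: thue_morse_def)

lemma thue_morse_double_Suc: "thue_morse (2 * n + 1) = 1 - thue_morse n"
proof -
  have "thue_morse n < 2" by (simp add: thue_morse_def)
  then have "thue_morse n = 0 \<or> thue_morse n = 1" by linarith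
  then show ?thesis
    using thue_morse_step[of 1 n] by auto
qed

end

theory Submission
  imports Defs "HOL-Analysis.Infinite_Products"
begin

text \<open>
  Consecutive Thue-Morse signs at \<open>2 * n\<close> and \<open>2 * n + 1\<close> are opposite, so the partial products
  \<open>P N\<close> of \<open>(n + a) / (n + b)\<close> raised to these signs can be taken over pairs, whose factors are
  \<open>1 + O(1 / n\<^sup>2)\<close>. Hence \<open>P\<close> has a nonzero limit. The same pairing shows that the \<open>N\<close>-th partial
  product in (i) equals \<open>(b + 1) / (a + 1) * P N / P (2 * N + 1)\<close>, and the quotient of the
  two values of \<open>P\<close> tends to 1. The other parts are (i) with \<open>b = a + 1\<close>, \<open>b = 0\<close> and
  \<open>b = 2 * a - 1\<close>.
\<close>

text \<open>An integer rather than a natural number, because it serves as the exponent of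
  \<open>powi\<close>.\<close>

definition thue_morse_sign :: "nat \<Rightarrow> int" where
  "thue_morse_sign n = (- 1) ^ thue_morse n"

lemma thue_morse_cases: "thue_morse n = 0 \<or> thue_morse n = 1"
  unfolding thue_morse_def by presburger

lemma thue_morse_sign_cases: "thue_morse_sign n = 1 \<or> thue_morse_sign n = - 1"
  using thue_morse_cases[of n] by (auto simp: thue_morse_sign_def)

lemma thue_morse_sign_double: "thue_morse_sign (2 * n) = thue_morse_sign n"
  by (simp add: thue_morse_sign_def thue_morse_double)

lemma thue_morse_sign_double_Suc: "thue_morse_sign (Suc (2 * n)) = - thue_morse_sign n"
  using thue_morse_cases[of n] thue_morse_double_Suc[of n] by (auto simp: thue_morse_sign_def)

text \<open>The indices \<open>2 * n\<close> and \<open>2 * n + 1\<close> carry opposite signs, so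
  together they contribute one quotient with the sign of \<open>n\<close>. Index 1 is left alone, as
  its partner 0 lies outside the product; its sign is -1, whence the factor
  \<open>inverse (f 1)\<close>.\<close>

lemma prod_thue_morse_pairs:
  fixes f :: "nat \<Rightarrow> 'a::field"
  shows "(\<Prod>n=1..2 * N + 1. f n powi thue_morse_sign n)
    = inverse (f 1) * (\<Prod>n=1..N. (f (2 * n) / f (2 * n + 1)) powi thue_morse_sign n)"
proof (induction N)
  case 0
  have "thue_morse_sign (Suc 0) = - 1"
    using thue_morse_sign_double_Suc[of 0] by (simp add: thue_morse_sign_def thue_morse_0)
  then show ?case by (simp add: power_int_minus)
next
  case (Suc N)
  have signs: "thue_morse_sign (Suc (Suc (2 * N))) = thue_morse_sign (Suc N)"
    "thue_morse_sign (Suc (Suc (Suc (2 * N)))) = - thue_morse_sign (Suc N)"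
    using thue_morse_sign_double[of "Suc N"] thue_morse_sign_double_Suc[of "Suc N"] by simp_all
  have "(\<Prod>n=1..2 * Suc N + 1. f n powi thue_morse_sign n)
      = (\<Prod>n=1..2 * N + 1. f n powi thue_morse_sign n)
        * (f (2 * Suc N) / f (2 * Suc N + 1)) powi thue_morse_sign (Suc N)"
    by (simp add: signs power_int_minus power_int_mult_distrib power_int_inverse divide_inverse mult.assoc)
  then show ?case by (simp only: Suc.IH) simp
qed

lemma LIMSEQ_even_odd:
  assumes even: "(\<lambda>n. X (2 * n)) \<longlonglongrightarrow> L" and odd: "(\<lambda>n. X (2 * n + 1)) \<longlonglongrightarrow> L"
  shows "X \<longlonglongrightarrow> L"
proof (rule topological_tendstoI)
  fix S assume "open S" "L \<in> S"
  then have "\<forall>\<^sub>F n in sequentially. X (2 * n) \<in> S \<and> X (2 * n + 1) \<in> S"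
    using even odd by (auto intro: eventually_conj dest: topological_tendstoD)
  then obtain N where N: "\<And>n. n \<ge> N \<Longrightarrow> X (2 * n) \<in> S \<and> X (2 * n + 1) \<in> S"
    by (auto simp: eventually_sequentially)
  have "X n \<in> S" if "n \<ge> 2 * N" for n
  proof -
    have "n div 2 \<ge> N" using that by simp
    from N[OF this] show ?thesis
      by (cases "even n") auto
  qed
  then show "\<forall>\<^sub>F n in sequentially. X n \<in> S"
    by (auto simp: eventually_sequentially)
qed

lemma tendsto_of_nat_add_quotient:
  fixes a b :: "'a::real_normed_field"
  shows "(\<lambda>n. (of_nat n + a) / (of_nat n + b)) \<longlonglongrightarrow> 1"
proof -
  have inv: "(\<lambda>n. inverse (of_nat n :: 'a)) \<longlonglongrightarrow> 0"
    using lim_inverse_n by blast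
  have "(\<lambda>n. (1 + a * inverse (of_nat n)) / (1 + b * inverse (of_nat n))) \<longlonglongrightarrow> (1 + a * 0) / (1 + b * 0)"
    by (intro tendsto_intros inv) simp
  moreover have "\<forall>\<^sub>F n in sequentially. (1 + a * inverse (of_nat n)) / (1 + b * inverse (of_nat n))
      = (of_nat n + a) / (of_nat n + b)"
    using eventually_gt_at_top[of 0]
  proof eventually_elim
    case (elim n)
    have "(1 + c * inverse (of_nat n)) = (of_nat n + c) / of_nat n" for c :: 'a
      using elim by (simp add: field_simps)
    then show ?case using elim by simp
  qed
  ultimately show ?thesis by (simp cong: filterlim_cong)
qed

text \<open>Once \<open>real n\<close> exceeds \<open>norm d\<close>, the factor
  \<open>2 * of_nat n + d\<close> has norm at least n, so the terms are eventually dominated by a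
  multiple of the inverse squares. Terms of this shape bound the distance of the paired factors from
  1.\<close>

lemma summable_inverse_mult_linear:
  fixes a b c :: complex
  shows "summable (\<lambda>n. norm (c / ((2 * of_nat n + a) * (2 * of_nat n + b))))"
proof -
  have low: "\<forall>\<^sub>F n in sequentially. real n \<le> norm (2 * of_nat n + d)" for d :: complex
    using filterlim_real_sequentially[unfolded filterlim_at_top, rule_format, of "norm d"]
  proof eventually_elim
    case (elim n)
    have "norm (2 * of_nat n :: complex) \<le> norm (2 * of_nat n + d) + norm d"
      using norm_triangle_ineq4[of "2 * of_nat n + d" d] by simp
    with elim show ?case by (simp add: norm_mult)
  qed
  have "\<forall>\<^sub>F n in sequentially. norm (norm (c / ((2 * of_nat n + a) * (2 * of_nat n + b))))
      \<le> norm c * inverse (real n ^ 2)"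
    using low[of a] low[of b] eventually_gt_at_top[of 0]
  proof eventually_elim
    case (elim n)
    have "real n ^ 2 \<le> norm (2 * of_nat n + a) * norm (2 * of_nat n + b)"
      unfolding power2_eq_square using elim by (intro mult_mono) auto
    then have "norm c * inverse (norm (2 * of_nat n + a) * norm (2 * of_nat n + b))
        \<le> norm c * inverse (real n ^ 2)"
      using elim by (intro mult_left_mono le_imp_inverse_le) auto
    then show ?case
      by (simp add: norm_divide norm_mult norm_inverse divide_inverse)
  qed
  then show ?thesis
    by (rule summable_comparison_test_ev) (intro summable_mult inverse_power_summable, simp)
qed

lemma thue_morse_prod_convergent:
  fixes a b :: complex
  assumes a: "\<And>n. n \<ge> 1 \<Longrightarrow> of_nat n + a \<noteq> 0" and b: "\<And>n. n \<ge> 1 \<Longrightarrow> of_nat n + b \<noteq> 0"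
  obtains L where "L \<noteq> 0"
    "(\<lambda>N. \<Prod>n=1..N. ((of_nat n + a) / (of_nat n + b)) powi thue_morse_sign n) \<longlonglongrightarrow> L"
proof -
  define f where "f n = (of_nat n + a) / (of_nat n + b)" for n
  define P where "P N = (\<Prod>n=1..N. f n powi thue_morse_sign n)" for N
  define g where "g n = (f (2 * n) / f (2 * n + 1)) powi thue_morse_sign n" for n
  have f0: "f n \<noteq> 0" if "n \<ge> 1" for n
    using a[OF that] b[OF that] by (simp add: f_def)
  \<comment> \<open>One of the two summands equals the left-hand side, depending on the sign of n;
    their sum covers both signs. In each numerator the terms containing n cancel, which leaves the
    constant \<open>a - b\<close> or \<open>b - a\<close>.\<close>
  have bound: "norm (g n - 1) \<le> norm ((a - b) / ((2 * of_nat n + b) * (2 * of_nat n + (1 + a))))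
      + norm ((b - a) / ((2 * of_nat n + a) * (2 * of_nat n + (1 + b))))" if "n \<ge> 1" for n
  proof -
    have nz: "2 * of_nat n + a \<noteq> 0" "2 * of_nat n + b \<noteq> 0"
      "2 * of_nat n + (1 + a) \<noteq> 0" "2 * of_nat n + (1 + b) \<noteq> 0"
      using a[of "2 * n"] b[of "2 * n"] a[of "2 * n + 1"] b[of "2 * n + 1"] that
      by (simp_all add: ac_simps)
    have f: "f (2 * n) = (2 * of_nat n + a) / (2 * of_nat n + b)"
      "f (2 * n + 1) = (2 * of_nat n + (1 + a)) / (2 * of_nat n + (1 + b))"
      by (simp_all add: f_def ac_simps)
    have "f (2 * n) / f (2 * n + 1) - 1 = (a - b) / ((2 * of_nat n + b) * (2 * of_nat n + (1 + a)))"
      "inverse (f (2 * n) / f (2 * n + 1)) - 1 = (b - a) / ((2 * of_nat n + a) * (2 * of_nat n + (1 + b)))"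
      unfolding f using nz by (simp_all add: divide_simps) (simp_all add: algebra_simps)
    then show ?thesis
      using thue_morse_sign_cases[of n] unfolding g_def by (auto simp: power_int_minus)
  qed
  have "summable (\<lambda>n. norm (g n - 1))"
  proof (rule summable_comparison_test_ev)
    show "\<forall>\<^sub>F n in sequentially. norm (norm (g n - 1))
        \<le> norm ((a - b) / ((2 * of_nat n + b) * (2 * of_nat n + (1 + a))))
          + norm ((b - a) / ((2 * of_nat n + a) * (2 * of_nat n + (1 + b))))"
      using eventually_ge_at_top[of 1] by eventually_elim (simp only: real_norm_def abs_norm_cancel bound)
  qed (intro summable_add summable_inverse_mult_linear)
  \<comment> \<open>The shift drops \<open>g 0\<close>, which vanishes for instance when a = 0. All
    later factors are nonzero, so the infinite product is nonzero too.\<close>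
  then have "summable (\<lambda>n. norm (g (Suc n) - 1))"
    by (rule summable_Suc_iff[THEN iffD2])
  then have conv: "convergent_prod (\<lambda>n. g (Suc n))"
    by (intro abs_convergent_prod_imp_convergent_prod summable_imp_abs_convergent_prod)
  have "g (Suc n) \<noteq> 0" for n
    using f0[of "2 * Suc n"] f0[of "2 * Suc n + 1"] by (simp add: g_def)
  then have G0: "prodinf (\<lambda>n. g (Suc n)) \<noteq> 0"
    using prodinf_nonzero[OF conv] by blast
  define L where "L = inverse (f 1) * prodinf (\<lambda>n. g (Suc n))"
  have L0: "L \<noteq> 0" using G0 f0[of 1] by (simp add: L_def)
  have "(\<lambda>N. \<Prod>n<N. g (Suc n)) \<longlonglongrightarrow> prodinf (\<lambda>n. g (Suc n))"
    using convergent_prod_LIMSEQ[OF conv] LIMSEQ_lessThan_iff_atMost by blast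
  then have "(\<lambda>N. \<Prod>n=1..N. g n) \<longlonglongrightarrow> prodinf (\<lambda>n. g (Suc n))"
    by (simp add: prod.atLeast1_atMost_eq)
  then have odd: "(\<lambda>N. P (2 * N + 1)) \<longlonglongrightarrow> L"
    unfolding P_def prod_thue_morse_pairs L_def g_def by (intro tendsto_mult tendsto_const)
  have f1: "(\<lambda>N. f (2 * N + 1)) \<longlonglongrightarrow> 1"
    using LIMSEQ_subseq_LIMSEQ[OF tendsto_of_nat_add_quotient[of a b], of "\<lambda>N. 2 * N + 1"]
    by (simp add: f_def o_def strict_mono_def)
  \<comment> \<open>Passing from \<open>P (2 * N + 1)\<close> back to \<open>P (2 * N)\<close>
    multiplies by this power of \<open>f (2 * N + 1)\<close>. Its exponent keeps changing sign, so
    the bound again adds the errors of the base and of its inverse.\<close>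
  have "(\<lambda>N. f (2 * N + 1) powi thue_morse_sign N - 1) \<longlonglongrightarrow> 0"
  proof (rule Lim_null_comparison)
    show "\<forall>\<^sub>F N in sequentially. norm (f (2 * N + 1) powi thue_morse_sign N - 1)
        \<le> norm (f (2 * N + 1) - 1) + norm (inverse (f (2 * N + 1)) - 1)"
    proof (rule always_eventually, rule allI)
      fix N show "norm (f (2 * N + 1) powi thue_morse_sign N - 1)
        \<le> norm (f (2 * N + 1) - 1) + norm (inverse (f (2 * N + 1)) - 1)"
        using thue_morse_sign_cases[of N] by (auto simp: power_int_minus)
    qed
    have "(\<lambda>N. norm (f (2 * N + 1) - 1) + norm (inverse (f (2 * N + 1)) - 1))
        \<longlonglongrightarrow> norm (1 - 1 :: complex) + norm (inverse 1 - 1 :: complex)"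
      by (intro tendsto_intros f1) simp
    then show "(\<lambda>N. norm (f (2 * N + 1) - 1) + norm (inverse (f (2 * N + 1)) - 1)) \<longlonglongrightarrow> 0"
      by simp
  qed
  then have "(\<lambda>N. f (2 * N + 1) powi thue_morse_sign N) \<longlonglongrightarrow> 1"
    by (simp add: LIM_zero_iff)
  from tendsto_mult[OF odd this]
  have "(\<lambda>N. P (2 * N + 1) * f (2 * N + 1) powi thue_morse_sign N) \<longlonglongrightarrow> L" by simp
  moreover have "P (2 * N + 1) * f (2 * N + 1) powi thue_morse_sign N = P (2 * N)" for N
    using f0[of "2 * N + 1"] by (simp add: P_def thue_morse_sign_double_Suc power_int_minus)
  ultimately have "(\<lambda>N. P (2 * N)) \<longlonglongrightarrow> L" by simp
  then have "P \<longlonglongrightarrow> L"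
    by (rule LIMSEQ_even_odd) (fact odd)
  with L0 show ?thesis
    unfolding P_def[abs_def] f_def by (rule that)
qed

lemma thue_morse_prod_quotient:
  fixes a b :: complex
  assumes a: "a \<notin> {- of_nat k |k::nat. k \<ge> 1}" and b: "b \<notin> {- of_nat k |k::nat. k \<ge> 1}"
  shows "(\<lambda>N. \<Prod>n=1..N. (((of_nat n + a) * (2 * of_nat n + a + 1) * (2 * of_nat n + b)) /
            ((2 * of_nat n + a) * (of_nat n + b) * (2 * of_nat n + b + 1)))
              powi ((- 1) ^ thue_morse n))
          \<longlonglongrightarrow> (b + 1) / (a + 1)"
proof -
  have nz: "of_nat n + a \<noteq> 0" "of_nat n + b \<noteq> 0" if "n \<ge> 1" for n
    using a b that by (auto simp: add_eq_0_iff)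
  define f where "f n = (of_nat n + a) / (of_nat n + b)" for n
  define P where "P N = (\<Prod>n=1..N. f n powi thue_morse_sign n)" for N
  obtain L where L: "L \<noteq> 0" "P \<longlonglongrightarrow> L"
    using thue_morse_prod_convergent[OF nz] unfolding P_def f_def by metis
  have f0: "f n \<noteq> 0" if "n \<ge> 1" for n
    using nz[OF that] by (simp add: f_def)
  have eq: "(\<Prod>n=1..N. (((of_nat n + a) * (2 * of_nat n + a + 1) * (2 * of_nat n + b)) /
            ((2 * of_nat n + a) * (of_nat n + b) * (2 * of_nat n + b + 1)))
              powi ((- 1) ^ thue_morse n)) = inverse (f 1) * (P N / P (2 * N + 1))" for N
  proof -
    \<comment> \<open>Pairing turns \<open>P (2 * N + 1)\<close> into a product over the same range
      1 to N, so the division can be done factor by factor. The \<open>inverse (f 1)\<close> in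
      front cancels the one that pairing produces.\<close>
    have "inverse (f 1) * (P N / P (2 * N + 1))
        = (\<Prod>n=1..N. (f n / (f (2 * n) / f (2 * n + 1))) powi thue_morse_sign n)"
      unfolding prod_thue_morse_pairs P_def using f0[of 1]
      by (simp add: prod_dividef power_int_divide_distrib power_int_mult_distrib prod.distrib)
    also have "\<dots> = (\<Prod>n=1..N. (((of_nat n + a) * (2 * of_nat n + a + 1) * (2 * of_nat n + b)) /
            ((2 * of_nat n + a) * (of_nat n + b) * (2 * of_nat n + b + 1)))
              powi ((- 1) ^ thue_morse n))"
      by (rule prod.cong) (simp_all add: f_def thue_morse_sign_def ac_simps)
    finally show ?thesis ..
  qed
  have "(\<lambda>N. P (2 * N + 1)) \<longlonglongrightarrow> L"
    using LIMSEQ_subseq_LIMSEQ[OF L(2), of "\<lambda>N. 2 * N + 1"]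
    by (simp add: o_def strict_mono_def)
  then have "(\<lambda>N. inverse (f 1) * (P N / P (2 * N + 1))) \<longlonglongrightarrow> inverse (f 1) * (L / L)"
    by (intro tendsto_intros L)
  \<comment> \<open>The unknown limit cancels because it is nonzero; only the value at the unpaired
    index 1 survives.\<close>
  moreover have "inverse (f 1) * (L / L) = (b + 1) / (a + 1)"
    using L(1) by (simp add: f_def add.commute)
  ultimately show ?thesis
    unfolding eq by simp
qed

theorem corollary2p3:
  shows
    "(\<forall>a b :: complex. a \<notin> {- of_nat k |k::nat. k \<ge> 1} \<longrightarrow> b \<notin> {- of_nat k |k::nat. k \<ge> 1} \<longrightarrow>
        (\<lambda>N. \<Prod>n=1..N. (((of_nat n + a) * (2 * of_nat n + a + 1) * (2 * of_nat n + b)) /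
            ((2 * of_nat n + a) * (of_nat n + b) * (2 * of_nat n + b + 1)))
              powi ((- 1) ^ thue_morse n))
          \<longlonglongrightarrow> (b + 1) / (a + 1)) \<and>
     (\<forall>a :: complex. a \<notin> {- of_nat k |k::nat. k \<ge> 1} \<longrightarrow>
        (\<lambda>N. \<Prod>n=1..N. (((of_nat n + a) * (2 * of_nat n + a + 1) ^ 2) /
            ((2 * of_nat n + a) * (2 * of_nat n + a + 2) * (of_nat n + a + 1)))
              powi ((- 1) ^ thue_morse n))
          \<longlonglongrightarrow> (a + 2) / (a + 1)) \<and>
     (\<forall>a :: complex. a \<notin> {- of_nat k |k::nat. k \<ge> 1} \<longrightarrow>
        (\<lambda>N. \<Prod>n=1..N. (((2 * of_nat n + 2 * a) * (2 * of_nat n + a + 1)) /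
            ((2 * of_nat n + a) * (2 * of_nat n + 1)))
              powi ((- 1) ^ thue_morse n))
          \<longlonglongrightarrow> 1 / (a + 1)) \<and>
     (\<forall>a :: complex. a \<notin> {- of_nat k |k::nat. True} \<union> {- ((2 * of_nat k + 1) / 2) |k::nat. True} \<longrightarrow>
        (\<lambda>N. \<Prod>n=1..N. (((2 * of_nat n + a + 1) * (2 * of_nat n + 2 * a - 1)) /
            ((2 * of_nat n + a) * (2 * of_nat n + 4 * a - 2)))
              powi ((- 1) ^ thue_morse n))
          \<longlonglongrightarrow> 2 * a / (a + 1))"
proof (intro conjI allI impI)
  fix a b :: complex
  assume "a \<notin> {- of_nat k |k::nat. k \<ge> 1}" "b \<notin> {- of_nat k |k::nat. k \<ge> 1}"
  then show "(\<lambda>N. \<Prod>n=1..N. (((of_nat n + a) * (2 * of_nat n + a + 1) * (2 * of_nat n + b)) /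
            ((2 * of_nat n + a) * (of_nat n + b) * (2 * of_nat n + b + 1)))
              powi ((- 1) ^ thue_morse n))
          \<longlonglongrightarrow> (b + 1) / (a + 1)"
    by (rule thue_morse_prod_quotient)
next
  fix a :: complex
  assume a: "a \<notin> {- of_nat k |k::nat. k \<ge> 1}"
  have b: "a + 1 \<notin> {- of_nat k |k::nat. k \<ge> 1}"
  proof
    assume "a + 1 \<in> {- of_nat k |k::nat. k \<ge> 1}"
    then obtain k :: nat where "a + 1 = - of_nat k" by blast
    then have "a = - of_nat (Suc k)" by (simp add: eq_diff_eq[symmetric])
    moreover have "Suc k \<ge> 1" by simp
    ultimately show False using a by blast
  qed
  show "(\<lambda>N. \<Prod>n=1..N. (((of_nat n + a) * (2 * of_nat n + a + 1) ^ 2) /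
            ((2 * of_nat n + a) * (2 * of_nat n + a + 2) * (of_nat n + a + 1)))
              powi ((- 1) ^ thue_morse n))
          \<longlonglongrightarrow> (a + 2) / (a + 1)"
    \<comment> \<open>For b = a + 1 the factor 2n + b coincides with 2n + a + 1, which gives the
      square.\<close>
    using thue_morse_prod_quotient[OF a b] by (simp add: power2_eq_square ac_simps)
next
  fix a :: complex
  assume a: "a \<notin> {- of_nat k |k::nat. k \<ge> 1}"
  \<comment> \<open>The case b = 0, with the zeros kept so that the left side matches the instance
    literally. Here (n + a) * 2n = n * (2n + 2a), and n cancels since the product starts at
    1.\<close>
  have eq: "((of_nat n + a) * (2 * of_nat n + a + 1) * (2 * of_nat n + 0)) /
            ((2 * of_nat n + a) * (of_nat n + 0) * (2 * of_nat n + 0 + 1))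
      = ((2 * of_nat n + 2 * a) * (2 * of_nat n + a + 1)) / ((2 * of_nat n + a) * (2 * of_nat n + 1))"
    if "n \<in> {1..N}" for n N :: nat
  proof -
    have "((of_nat n + a) * (2 * of_nat n + a + 1) * (2 * of_nat n + 0)) /
            ((2 * of_nat n + a) * (of_nat n + 0) * (2 * of_nat n + 0 + 1))
      = (of_nat n * ((2 * of_nat n + 2 * a) * (2 * of_nat n + a + 1)))
          / (of_nat n * ((2 * of_nat n + a) * (2 * of_nat n + 1)))"
      by (intro arg_cong2[where f = divide]) (simp_all add: algebra_simps)
    with that show ?thesis by simp
  qed
  have "0 \<notin> {- of_nat k :: complex |k::nat. k \<ge> 1}" by auto
  from thue_morse_prod_quotient[OF a this]
  show "(\<lambda>N. \<Prod>n=1..N. (((2 * of_nat n + 2 * a) * (2 * of_nat n + a + 1)) /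
            ((2 * of_nat n + a) * (2 * of_nat n + 1)))
              powi ((- 1) ^ thue_morse n))
          \<longlonglongrightarrow> 1 / (a + 1)"
    by (simp only: eq cong: prod.cong) simp
next
  fix a :: complex
  assume a: "a \<notin> {- of_nat k |k::nat. True} \<union> {- ((2 * of_nat k + 1) / 2) |k::nat. True}"
  then have a': "a \<notin> {- of_nat k |k::nat. k \<ge> 1}" by blast
  have b: "2 * a - 1 \<notin> {- of_nat k |k::nat. k \<ge> 1}"
  proof
    assume "2 * a - 1 \<in> {- of_nat k |k::nat. k \<ge> 1}"
    then obtain k :: nat where "2 * a - 1 = - of_nat k" "k \<ge> 1" by blast
    \<comment> \<open>With k = j + 1 the equation becomes a = -j/2. Even j gives a nonpositive
      integer (0 included) and odd j a negative half-integer: exactly the two excluded sets.\<close>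
    then obtain j where "2 * a - 1 = - of_nat (Suc j)"
      by (metis Suc_le_D One_nat_def)
    then have "(2 * a - 1 + 1) / 2 = (- of_nat (Suc j) + 1) / 2" by (simp only:)
    then have j: "a = - (of_nat j / 2)" by simp
    show False
    proof (cases "even j")
      case True
      then obtain i where "j = 2 * i" by blast
      with j have "a = - of_nat i" by simp
      with a show False by blast
    next
      case False
      then obtain i where "j = 2 * i + 1" by (elim oddE)
      with j have "a = - ((2 * of_nat i + 1) / 2)" by simp
      with a show False by blast
    qed
  qed
  \<comment> \<open>For b = 2a - 1 the factor 2n + b + 1 is 2(n + a). It cancels against n + a, and
    the remaining 2 turns n + 2a - 1 into 2n + 4a - 2.\<close>
  have eq: "((of_nat n + a) * (2 * of_nat n + a + 1) * (2 * of_nat n + (2 * a - 1))) /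
            ((2 * of_nat n + a) * (of_nat n + (2 * a - 1)) * (2 * of_nat n + (2 * a - 1) + 1))
      = ((2 * of_nat n + a + 1) * (2 * of_nat n + 2 * a - 1)) /
            ((2 * of_nat n + a) * (2 * of_nat n + 4 * a - 2))"
    if "n \<in> {1..N}" for n N :: nat
  proof -
    have "of_nat n + a \<noteq> 0" using a by (auto simp: add_eq_0_iff)
    moreover have "((of_nat n + a) * (2 * of_nat n + a + 1) * (2 * of_nat n + (2 * a - 1))) /
            ((2 * of_nat n + a) * (of_nat n + (2 * a - 1)) * (2 * of_nat n + (2 * a - 1) + 1))
      = ((of_nat n + a) * ((2 * of_nat n + a + 1) * (2 * of_nat n + 2 * a - 1))) /
            ((of_nat n + a) * ((2 * of_nat n + a) * (2 * of_nat n + 4 * a - 2)))"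
      by (intro arg_cong2[where f = divide]) (simp_all add: algebra_simps)
    ultimately show ?thesis by simp
  qed
  show "(\<lambda>N. \<Prod>n=1..N. (((2 * of_nat n + a + 1) * (2 * of_nat n + 2 * a - 1)) /
            ((2 * of_nat n + a) * (2 * of_nat n + 4 * a - 2)))
              powi ((- 1) ^ thue_morse n))
          \<longlonglongrightarrow> 2 * a / (a + 1)"
    using thue_morse_prod_quotient[OF a' b] by (simp only: eq cong: prod.cong) simp
qed

end
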